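(* Let $D\ge1$ and define $P_D\colon\bigotimes^D\mathbb{C}^D\to\mathbb{C}$ by $$P_D(v)=\sum_{\sigma_1,\dots,\sigma_{D+1}\in S_D}\Big[\prod_{j=1}^{D+1}\mathrm{sgn}(\sigma_j)\Big]\prod_{i=1}^{D+1}v\big(\sigma_i(1),\sigma_{i+1}(2),\dots,\sigma_{i+D-1}(D)\big),$$ where the indices of the $\sigma$'s are taken modulo $D+1$ in $\{1,\dots,D+1\}$. (1) We have $P_D(gv)=(\det g)^{D+1}P_D(v)$ for all $g\in\mathrm{GL}_D$ and $v\in\bigotimes^D\mathbb{C}^D$. (2) The polynomial $P_D$, as a polynomial function on the space $\mathrm{Sym}^D\mathbb{C}^D$ of symmetric tensors, is nonzero if and only if $D$ is odd.
   Context: A tensor $v\in\bigotimes^D\mathbb{C}^D$ is written in coordinates as $v=\sum_{1\le\nu_1,\dots,\nu_D\le D}v(\nu_1,\dots,\nu_D)\,e_{\nu_1}\otimes\cdots\otimes e_{\nu_D}$, where $e_1,\dots,e_D$ is the standard basis of $\mathbb{C}^D$. $\mathrm{GL}_D$ acts by $gv:=g^{\otimes D}(v)$. $\mathrm{Sym}^D\mathbb{C}^D$, the space of degree $D$ forms in $D$ variables, is identified with the subspace of symmetric tensors of $\bigotimes^D\mathbb{C}^D$. *)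

theory Defs
  imports
    "Jordan_Normal_Form.Determinant"
    "HOL-Combinatorics.Permutations"
    "HOL-Library.FuncSet"
    Complex_Main
begin

text \<open>
  The basis of \<open>\<complex>\<^sup>D\<close>, the tensor slots and the points permuted by \<open>S\<^sub>D\<close> are numbered
  \<open>0, \<dots>, D - 1\<close>, as the matrix library does, instead of \<open>1, \<dots>, D\<close>.
\<close>

definition multi_idx :: "nat \<Rightarrow> (nat \<Rightarrow> nat) set" where
  "multi_idx D = ({0..<D} \<rightarrow>\<^sub>E {0..<D})"

text \<open>
  An element of \<open>\<Otimes>\<^sup>D \<complex>\<^sup>D\<close> is its coordinate function on multi-indices. The value is fixed
  to 0 elsewhere, so that equality of tensors and the pointwise linear operations are those of HOL.
\<close>

definition tensors :: "nat \<Rightarrow> ((nat \<Rightarrow> nat) \<Rightarrow> complex) set" where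
  "tensors D = {v. \<forall>\<nu>. \<nu> \<notin> multi_idx D \<longrightarrow> v \<nu> = 0}"

definition pure_tensor :: "nat \<Rightarrow> (nat \<Rightarrow> complex vec) \<Rightarrow> (nat \<Rightarrow> nat) \<Rightarrow> complex" where
  "pure_tensor D w = (\<lambda>\<mu>. if \<mu> \<in> multi_idx D then \<Prod>k\<in>{0..<D}. w k $ \<mu> k else 0)"

definition GL :: "nat \<Rightarrow> complex mat set" where
  "GL D = {g \<in> carrier_mat D D. invertible_mat g}"

text \<open>
  \<open>g\<^sup>\<otimes>\<^sup>D\<close> is the linear map sending each basis tensor \<open>e\<^sub>\<nu>\<close> to the pure tensor with
  factors \<open>g e\<^bsub>\<nu> 0\<^esub>, \<dots>, g e\<^bsub>\<nu> (D - 1)\<^esub>\<close>.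
\<close>

definition tensor_act ::
  "nat \<Rightarrow> complex mat \<Rightarrow> ((nat \<Rightarrow> nat) \<Rightarrow> complex) \<Rightarrow> (nat \<Rightarrow> nat) \<Rightarrow> complex" where
  "tensor_act D g v =
     (\<lambda>\<mu>. \<Sum>\<nu>\<in>multi_idx D. v \<nu> * pure_tensor D (\<lambda>k. g *\<^sub>v unit_vec D (\<nu> k)) \<mu>)"

text \<open>Precomposing \<open>\<nu>\<close> with a permutation of the slots permutes the tensor factors.\<close>

definition sym_tensors :: "nat \<Rightarrow> ((nat \<Rightarrow> nat) \<Rightarrow> complex) set" where
  "sym_tensors D =
     {v \<in> tensors D. \<forall>\<pi>. \<pi> permutes {0..<D} \<longrightarrow> (\<forall>\<nu>\<in>multi_idx D. v (\<nu> \<circ> \<pi>) = v \<nu>)}"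

text \<open>
  The \<open>D + 1\<close> permutations are also numbered from 0, with indices modulo \<open>D + 1\<close>.
\<close>

definition P_poly :: "nat \<Rightarrow> ((nat \<Rightarrow> nat) \<Rightarrow> complex) \<Rightarrow> complex" where
  "P_poly D v =
     (\<Sum>\<sigma> \<in> {0..<D+1} \<rightarrow>\<^sub>E {p. p permutes {0..<D}}.
        (\<Prod>j\<in>{0..<D+1}. of_int (sign (\<sigma> j))) *
        (\<Prod>i\<in>{0..<D+1}. v (\<lambda>k\<in>{0..<D}. \<sigma> ((i + k) mod (D + 1)) k)))"

lemma tensor_basis_expansion:
  assumes "v \<in> tensors D"
  shows "v = (\<lambda>\<mu>. \<Sum>\<nu>\<in>multi_idx D. v \<nu> * pure_tensor D (\<lambda>k. unit_vec D (\<nu> k)) \<mu>)"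
proof
  fix \<mu>
  have fin: "finite (multi_idx D)"
    unfolding multi_idx_def by (intro finite_PiE) auto
  show "v \<mu> = (\<Sum>\<nu>\<in>multi_idx D. v \<nu> * pure_tensor D (\<lambda>k. unit_vec D (\<nu> k)) \<mu>)"
  proof (cases "\<mu> \<in> multi_idx D")
    case True
    have "pure_tensor D (\<lambda>k. unit_vec D (\<nu> k)) \<mu> = (if \<nu> = \<mu> then 1 else 0)"
      if \<nu>: "\<nu> \<in> multi_idx D" for \<nu>
    proof (cases "\<nu> = \<mu>")
      case eq: True
      have "\<mu> k < D" if "k < D" for k
        using True that unfolding multi_idx_def by auto
      then show ?thesis
        using True eq by (simp add: pure_tensor_def)
    next
      case False
      then obtain k where k: "k \<in> {0..<D}" "\<nu> k \<noteq> \<mu> k"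
        using True \<nu> unfolding multi_idx_def by (metis PiE_ext)
      have "\<nu> k < D" "\<mu> k < D"
        using True \<nu> k unfolding multi_idx_def by auto
      with k have "unit_vec D (\<nu> k) $ \<mu> k = (0 :: complex)" by simp
      with k have "(\<Prod>k\<in>{0..<D}. unit_vec D (\<nu> k) $ \<mu> k) = (0 :: complex)"
        by (intro prod_zero) auto
      with False show ?thesis by (simp add: pure_tensor_def)
    qed
    then have "(\<Sum>\<nu>\<in>multi_idx D. v \<nu> * pure_tensor D (\<lambda>k. unit_vec D (\<nu> k)) \<mu>)
        = (\<Sum>\<nu>\<in>multi_idx D. if \<nu> = \<mu> then v \<nu> else 0)"
      by (intro sum.cong) auto
    with True fin show ?thesis by simp
  next
    case False
    with assms show ?thesis by (simp add: tensors_def pure_tensor_def)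
  qed
qed

lemma tensor_act_pure_tensor:
  assumes g: "g \<in> carrier_mat D D" and w: "\<And>k. k < D \<Longrightarrow> w k \<in> carrier_vec D"
  shows "tensor_act D g (pure_tensor D w) = pure_tensor D (\<lambda>k. g *\<^sub>v w k)"
proof
  fix \<mu>
  show "tensor_act D g (pure_tensor D w) \<mu> = pure_tensor D (\<lambda>k. g *\<^sub>v w k) \<mu>"
  proof (cases "\<mu> \<in> multi_idx D")
    case True
    then have \<mu>: "\<mu> k < D" if "k < D" for k
      using that unfolding multi_idx_def by auto
    have "tensor_act D g (pure_tensor D w) \<mu>
        = (\<Sum>\<nu>\<in>multi_idx D. (\<Prod>k\<in>{0..<D}. w k $ \<nu> k) * (\<Prod>k\<in>{0..<D}. g $$ (\<mu> k, \<nu> k)))"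
      unfolding tensor_act_def
    proof (intro sum.cong refl)
      fix \<nu> assume \<nu>: "\<nu> \<in> multi_idx D"
      have "(g *\<^sub>v unit_vec D (\<nu> k)) $ \<mu> k = g $$ (\<mu> k, \<nu> k)" if "k < D" for k
      proof -
        have "\<nu> k < D" using \<nu> that unfolding multi_idx_def by auto
        with g \<mu>[OF that] show ?thesis by (simp add: scalar_prod_right_unit)
      qed
      with \<nu> True show "pure_tensor D w \<nu> * pure_tensor D (\<lambda>k. g *\<^sub>v unit_vec D (\<nu> k)) \<mu>
          = (\<Prod>k\<in>{0..<D}. w k $ \<nu> k) * (\<Prod>k\<in>{0..<D}. g $$ (\<mu> k, \<nu> k))"
        by (simp add: pure_tensor_def)
    qed
    also have "\<dots> = (\<Sum>\<nu>\<in>{0..<D} \<rightarrow>\<^sub>E {0..<D}. \<Prod>k\<in>{0..<D}. g $$ (\<mu> k, \<nu> k) * w k $ \<nu> k)"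
      by (simp add: multi_idx_def prod.distrib mult.commute)
    also have "\<dots> = (\<Prod>k\<in>{0..<D}. \<Sum>j\<in>{0..<D}. g $$ (\<mu> k, j) * w k $ j)"
      by (subst prod_sum_PiE) auto
    also have "\<dots> = (\<Prod>k\<in>{0..<D}. (g *\<^sub>v w k) $ \<mu> k)"
    proof (intro prod.cong refl)
      fix k assume "k \<in> {0..<D}"
      then have "\<mu> k < D" "dim_vec (w k) = D" using \<mu> w by auto
      with g show "(\<Sum>j\<in>{0..<D}. g $$ (\<mu> k, j) * w k $ j) = (g *\<^sub>v w k) $ \<mu> k"
        by (auto simp: scalar_prod_def intro!: sum.cong)
    qed
    finally show ?thesis using True by (simp add: pure_tensor_def)
  next
    case False
    then show ?thesis by (simp add: tensor_act_def pure_tensor_def)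
  qed
qed

end

theory Submission
  imports Defs
begin

text \<open>
  In each factor of a term the \<open>D\<close> arguments come from \<open>D\<close> different permutations, and each
  permutation supplies every slot exactly once. So if a tensor is a combination of pure tensors, choosing one pure summand for
  each of the \<open>D + 1\<close> factors turns the sum over each permutation \<open>\<sigma>\<^sub>m\<close> separately into a
  determinant, whose \<open>j\<close>-th row is the \<open>j\<close>-th vector of the summand chosen in factor \<open>m - j\<close>
  (lemma \<open>P_poly_sum_of_products\<close>). Expanding \<open>v\<close> in the standard basis, \<open>g\<close> multiplies each of the
  \<open>D + 1\<close> determinants by \<open>det g\<close>; this is the equivariance.

  For a combination of powers \<open>\<ell>\<^sup>\<otimes>\<^sup>D\<close>, the choice of summands is a cyclic sequence
  \<open>a\<^sub>0, \<dots>, a\<^sub>D\<close> of vectors, and the determinants are those of its \<open>D + 1\<close> cyclic windows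
  of length \<open>D\<close>. Every window omits exactly one of the vectors, so permuting the sequence by
  \<open>\<pi>\<close> permutes the windows up to row order; the signs multiply to \<open>sgn(\<pi>)\<^bsup>D+1\<^esup>\<close>
  (lemma \<open>window_product_permute\<close>).

  If \<open>D\<close> is even, swapping two entries of the sequence changes the sign of its contribution. Every
  symmetric tensor is a combination of powers by polarization, hence the polynomial vanishes on
  it. If \<open>D\<close> is odd, take the sum of the powers of \<open>e\<^sub>0, \<dots>, e\<^bsub>D-1\<^esub>\<close> and of
  \<open>e\<^sub>0 + \<dots> + e\<^bsub>D-1\<^esub>\<close>. For \<open>D \<ge> 2\<close> a sequence with a repetition contributes nothing, because
  some window contains both copies. The other sequences are the orderings of the \<open>D + 1\<close>
  vectors; they all contribute the same, and not 0, because any \<open>D\<close> of these vectors are a basis. For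
  \<open>D = 1\<close> the two vectors are equal, and all choices contribute the same.
\<close>

section \<open>Expansion into determinants, and equivariance\<close>

lemma finite_multi_idx [simp]: "finite (multi_idx D)"
  unfolding multi_idx_def by (intro finite_PiE) auto

lemma mod_add_sub_cancel:
  fixes i j :: nat
  assumes "i < n" "j < n"
  shows "((i + j) mod n + n - j) mod n = i" and "((i + n - j) mod n + j) mod n = i"
proof -
  have "i + j < n \<or> n \<le> i + j \<and> i + j < 2 * n" using assms by linarith
  then show "((i + j) mod n + n - j) mod n = i"
    using assms by (auto simp: mod_if[of "i + j"] le_mod_geq)
  have "((i + n - j) mod n + j) mod n = (i + n - j + j) mod n" by (simp add: mod_add_left_eq)
  then show "((i + n - j) mod n + j) mod n = i" using assms by simp
qed

lemma bij_betw_add_mod: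
  fixes j n :: nat
  assumes "j < n"
  shows "bij_betw (\<lambda>i. (i + j) mod n) {0..<n} {0..<n}"
  using assms mod_add_sub_cancel
  by (intro bij_betw_byWitness[where f' = "\<lambda>m. (m + n - j) mod n"]) auto

text \<open>
  Multiply out the factors, with \<open>f\<close> recording the summand chosen in factor \<open>i\<close>. The entry
  in slot \<open>j\<close> of factor \<open>i\<close> is governed by \<open>\<sigma>\<^sub>m\<close> with \<open>m = i + j\<close>. Collecting the entries by \<open>m\<close>
  instead of \<open>i\<close> separates the permutations, and each sum over \<open>\<sigma>\<^sub>m\<close> is a Leibniz formula.
\<close>
lemma P_poly_sum_of_products:
  fixes c :: "'s \<Rightarrow> complex" and a :: "'s \<Rightarrow> nat \<Rightarrow> nat \<Rightarrow> complex"
  assumes S: "finite S"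
    and v: "\<And>\<mu>. \<mu> \<in> multi_idx D \<Longrightarrow> v \<mu> = (\<Sum>s\<in>S. c s * (\<Prod>j\<in>{0..<D}. a s j (\<mu> j)))"
  shows "P_poly D v = (\<Sum>f\<in>{0..<D+1} \<rightarrow>\<^sub>E S. (\<Prod>i\<in>{0..<D+1}. c (f i)) *
           (\<Prod>m\<in>{0..<D+1}. det (mat D D (\<lambda>(j, r). a (f ((m + (D + 1) - j) mod (D + 1))) j r))))"
proof -
  define n where "n = D + 1"
  define Sg where "Sg = {p. p permutes {0..<D}}"
  have finSg: "finite Sg" unfolding Sg_def by (simp add: finite_permutations)
  have idx: "(\<lambda>k\<in>{0..<D}. \<sigma> ((i + k) mod n) k) \<in> multi_idx D"
    if "\<sigma> \<in> {0..<n} \<rightarrow>\<^sub>E Sg" for \<sigma> i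
  proof -
    have "\<sigma> ((i + k) mod n) k < D" if "k < D" for k
    proof -
      have "\<sigma> ((i + k) mod n) permutes {0..<D}"
        using \<open>\<sigma> \<in> _\<close> unfolding Sg_def n_def by (auto simp: PiE_iff)
      with that show ?thesis by (metis atLeastLessThan_iff permutes_in_image zero_le)
    qed
    then show ?thesis unfolding multi_idx_def by auto
  qed
  have swap: "(\<Prod>i\<in>{0..<n}. \<Prod>j\<in>{0..<D}. a (f i) j (\<sigma> ((i + j) mod n) j))
      = (\<Prod>m\<in>{0..<n}. \<Prod>j\<in>{0..<D}. a (f ((m + n - j) mod n)) j (\<sigma> m j))" for f \<sigma>
  proof -
    have "(\<Prod>i\<in>{0..<n}. a (f i) j (\<sigma> ((i + j) mod n) j))
        = (\<Prod>m\<in>{0..<n}. a (f ((m + n - j) mod n)) j (\<sigma> m j))" if "j \<in> {0..<D}" for j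
    proof -
      have j: "j < n" using that by (simp add: n_def)
      have "(\<Prod>m\<in>{0..<n}. a (f ((m + n - j) mod n)) j (\<sigma> m j))
          = (\<Prod>i\<in>{0..<n}. a (f (((i + j) mod n + n - j) mod n)) j (\<sigma> ((i + j) mod n) j))"
        by (rule prod.reindex_bij_betw[OF bij_betw_add_mod[OF j], symmetric])
      also have "\<dots> = (\<Prod>i\<in>{0..<n}. a (f i) j (\<sigma> ((i + j) mod n) j))"
        using j by (intro prod.cong refl) (simp add: mod_add_sub_cancel)
      finally show ?thesis by simp
    qed
    then have "(\<Prod>j\<in>{0..<D}. \<Prod>i\<in>{0..<n}. a (f i) j (\<sigma> ((i + j) mod n) j))
        = (\<Prod>j\<in>{0..<D}. \<Prod>m\<in>{0..<n}. a (f ((m + n - j) mod n)) j (\<sigma> m j))"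
      by (rule prod.cong[OF refl])
    then show ?thesis
      by (simp only: prod.swap[of _ "{0..<D}" "{0..<n}"])
  qed
  have "P_poly D v = (\<Sum>\<sigma>\<in>{0..<n} \<rightarrow>\<^sub>E Sg. (\<Prod>m\<in>{0..<n}. of_int (sign (\<sigma> m))) *
          (\<Prod>i\<in>{0..<n}. \<Sum>s\<in>S. c s * (\<Prod>j\<in>{0..<D}. a s j (\<sigma> ((i + j) mod n) j))))"
    unfolding P_poly_def n_def[symmetric] Sg_def[symmetric]
    using idx by (intro sum.cong refl arg_cong2[where f = "(*)"] prod.cong) (simp add: v)
  also have "\<dots> = (\<Sum>\<sigma>\<in>{0..<n} \<rightarrow>\<^sub>E Sg. \<Sum>f\<in>{0..<n} \<rightarrow>\<^sub>E S. (\<Prod>i\<in>{0..<n}. c (f i)) *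
          (\<Prod>m\<in>{0..<n}. of_int (sign (\<sigma> m)) *
             (\<Prod>j\<in>{0..<D}. a (f ((m + n - j) mod n)) j (\<sigma> m j))))"
    by (simp add: prod_sum_PiE S sum_distrib_left prod.distrib swap mult_ac)
  also have "\<dots> = (\<Sum>f\<in>{0..<n} \<rightarrow>\<^sub>E S. (\<Prod>i\<in>{0..<n}. c (f i)) *
          (\<Sum>\<sigma>\<in>{0..<n} \<rightarrow>\<^sub>E Sg. \<Prod>m\<in>{0..<n}. of_int (sign (\<sigma> m)) *
             (\<Prod>j\<in>{0..<D}. a (f ((m + n - j) mod n)) j (\<sigma> m j))))"
    by (subst sum.swap) (simp add: sum_distrib_left)
  also have "\<dots> = (\<Sum>f\<in>{0..<n} \<rightarrow>\<^sub>E S. (\<Prod>i\<in>{0..<n}. c (f i)) *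
          (\<Prod>m\<in>{0..<n}. \<Sum>p\<in>Sg. of_int (sign p) *
             (\<Prod>j\<in>{0..<D}. a (f ((m + n - j) mod n)) j (p j))))"
    by (subst prod_sum_PiE) (auto simp: finSg)
  also have "\<dots> = (\<Sum>f\<in>{0..<n} \<rightarrow>\<^sub>E S. (\<Prod>i\<in>{0..<n}. c (f i)) *
          (\<Prod>m\<in>{0..<n}. det (mat D D (\<lambda>(j, r). a (f ((m + n - j) mod n)) j r))))"
  proof -
    have "det (mat D D (\<lambda>(j, r). b j r)) = (\<Sum>p\<in>Sg. of_int (sign p) * (\<Prod>j\<in>{0..<D}. b j (p j)))"
      for b :: "nat \<Rightarrow> nat \<Rightarrow> complex"
    proof -
      have "(\<Prod>j\<in>{0..<D}. mat D D (\<lambda>(j, r). b j r) $$ (j, p j)) = (\<Prod>j\<in>{0..<D}. b j (p j))"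
        if "p \<in> Sg" for p
      proof (intro prod.cong refl)
        fix j assume "j \<in> {0..<D}"
        moreover from this have "p j \<in> {0..<D}" using that unfolding Sg_def
          by (simp add: permutes_in_image del: atLeastLessThan_iff)
        ultimately show "mat D D (\<lambda>(j, r). b j r) $$ (j, p j) = b j (p j)" by simp
      qed
      then show ?thesis
        by (subst det_def'[of _ D]) (auto simp: Sg_def intro!: sum.cong)
    qed
    then show ?thesis by simp
  qed
  finally show ?thesis unfolding n_def .
qed

lemma P_poly_tensor_act:
  assumes g: "g \<in> carrier_mat D D" and v: "v \<in> tensors D"
  shows "P_poly D (tensor_act D g v) = det g ^ (D + 1) * P_poly D v"
proof -
  define e :: "(nat \<Rightarrow> nat) \<Rightarrow> nat \<Rightarrow> nat \<Rightarrow> complex" where "e \<nu> j r = unit_vec D (\<nu> j) $ r" for \<nu> j r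
  define ge :: "(nat \<Rightarrow> nat) \<Rightarrow> nat \<Rightarrow> nat \<Rightarrow> complex" where "ge \<nu> j r = (g *\<^sub>v unit_vec D (\<nu> j)) $ r" for \<nu> j r
  let ?h = "\<lambda>f m j. f ((m + (D + 1) - j) mod (D + 1)) :: nat \<Rightarrow> nat"
  have P: "P_poly D v = (\<Sum>f\<in>{0..<D+1} \<rightarrow>\<^sub>E multi_idx D. (\<Prod>i\<in>{0..<D+1}. v (f i)) *
           (\<Prod>m\<in>{0..<D+1}. det (mat D D (\<lambda>(j, r). e (?h f m j) j r))))"
    by (rule P_poly_sum_of_products)
      (simp, subst tensor_basis_expansion[OF v], simp add: pure_tensor_def e_def)
  have gP: "P_poly D (tensor_act D g v)
      = (\<Sum>f\<in>{0..<D+1} \<rightarrow>\<^sub>E multi_idx D. (\<Prod>i\<in>{0..<D+1}. v (f i)) *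
           (\<Prod>m\<in>{0..<D+1}. det (mat D D (\<lambda>(j, r). ge (?h f m j) j r))))"
    by (rule P_poly_sum_of_products) (simp_all add: tensor_act_def pure_tensor_def ge_def)
  have det_ge: "det (mat D D (\<lambda>(j, r). ge (h j) j r)) = det g * det (mat D D (\<lambda>(j, r). e (h j) j r))"
    for h
  proof -
    have "mat D D (\<lambda>(j, r). ge (h j) j r) = mat D D (\<lambda>(j, r). e (h j) j r) * transpose_mat g"
      using g by (intro eq_matI) (auto simp: ge_def e_def scalar_prod_def mult.commute intro!: sum.cong)
    then show ?thesis
      using g by (simp add: det_mult[of _ D] det_transpose)
  qed
  show ?thesis
    unfolding gP P det_ge by (simp add: prod.distrib sum_distrib_left mult_ac)
qed

section \<open>Products of cyclic windows\<close>

text \<open>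
  The rows are the vectors of the cyclic sequence \<open>a\<^sub>0, \<dots>, a\<^sub>D\<close> listed backwards from
  \<open>a\<^bsub>q-1\<^esub>\<close> to \<open>a\<^bsub>q+1\<^esub>\<close>. Only \<open>a\<^sub>q\<close> is omitted, and it labels the window.
\<close>
definition window :: "nat \<Rightarrow> (nat \<Rightarrow> nat \<Rightarrow> complex) \<Rightarrow> nat \<Rightarrow> complex mat" where
  "window D a q = mat D D (\<lambda>(j, r). a ((q + D - j) mod (D + 1)) r)"

definition window_product :: "nat \<Rightarrow> (nat \<Rightarrow> nat \<Rightarrow> complex) \<Rightarrow> complex" where
  "window_product D a = (\<Prod>q\<in>{0..<D+1}. det (window D a q))"

lemma window_carrier [simp]: "window D a q \<in> carrier_mat D D"
  by (simp add: window_def)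

text \<open>
  Row \<open>j\<close> of window \<open>q\<close> is vector number \<open>reflect D q j\<close>. Adding the value at \<open>j = D\<close>, which is
  the omitted \<open>q\<close>, makes the row numbering an involution of all \<open>D + 1\<close> indices.
\<close>
definition reflect :: "nat \<Rightarrow> nat \<Rightarrow> nat \<Rightarrow> nat" where
  "reflect D q j = (if j < D + 1 then (q + D - j) mod (D + 1) else j)"

lemma reflect_reflect:
  assumes "q < D + 1"
  shows "reflect D q (reflect D q j) = j"
proof (cases "j < D + 1")
  case True
  have "q + D - j < D + 1 \<or> D + 1 \<le> q + D - j \<and> q + D - j < 2 * (D + 1)" using assms by arith
  then show ?thesis
    using True assms by (auto simp: reflect_def mod_if[of "q + D - j"] le_mod_geq)
qed (simp add: reflect_def)

lemma reflect_permutes: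
  assumes "q < D + 1"
  shows "reflect D q permutes {0..<D+1}"
proof (rule bij_imp_permutes)
  show "bij_betw (reflect D q) {0..<D+1} {0..<D+1}"
    by (rule bij_betw_byWitness[where f' = "reflect D q"])
      (simp_all only: reflect_reflect[OF assms], auto simp: reflect_def)
qed (simp add: reflect_def)

text \<open>
  Window \<open>q\<close> of the permuted sequence and window \<open>\<pi> q\<close> of the original one omit the same vector,
  so they agree up to the row permutation \<open>c\<close> that conjugates \<open>\<pi>\<close> by the two row numberings.
  The sign of \<open>c\<close> may be computed on \<open>D + 1\<close> points, as \<open>c\<close> fixes the row \<open>D\<close> of the omitted vector.
\<close>
lemma det_window_permute:
  assumes \<pi>: "\<pi> permutes {0..<D+1}" and q: "q < D + 1"
  shows "det (window D (a \<circ> \<pi>) q) =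
    of_int (sign (reflect D (\<pi> q)) * sign \<pi> * sign (reflect D q)) * det (window D a (\<pi> q))"
proof -
  have \<pi>q: "\<pi> q < D + 1" using \<pi> q by (metis atLeastLessThan_iff permutes_in_image zero_le)
  define c where "c = reflect D (\<pi> q) \<circ> \<pi> \<circ> reflect D q"
  note perms = reflect_permutes[OF q] reflect_permutes[OF \<pi>q] \<pi>
  have c: "c permutes {0..<D+1}" unfolding c_def by (intro permutes_compose perms)
  have "c D = D" using q \<pi>q by (simp add: c_def reflect_def)
  with c have cD: "c permutes {0..<D}"
    by (intro permutes_superset[OF c]) (auto simp: less_Suc_eq)
  have \<pi>_reflect: "\<pi> (reflect D q j) = reflect D (\<pi> q) (c j)" for j
    by (simp add: c_def reflect_reflect[OF \<pi>q])
  have "window D (a \<circ> \<pi>) q = mat D D (\<lambda>(j, r). window D a (\<pi> q) $$ (c j, r))"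
  proof (rule eq_matI)
    fix j r assume "j < dim_row (mat D D (\<lambda>(j, r). window D a (\<pi> q) $$ (c j, r)))"
      and "r < dim_col (mat D D (\<lambda>(j, r). window D a (\<pi> q) $$ (c j, r)))"
    then have j: "j < D" and r: "r < D" by auto
    moreover have "c j < D" using cD j by (metis atLeastLessThan_iff permutes_in_image zero_le)
    moreover have "\<pi> ((q + D - j) mod (D + 1)) = (\<pi> q + D - c j) mod (D + 1)"
      using \<pi>_reflect[of j] j \<open>c j < D\<close> by (simp add: reflect_def)
    ultimately show "window D (a \<circ> \<pi>) q $$ (j, r)
        = mat D D (\<lambda>(j, r). window D a (\<pi> q) $$ (c j, r)) $$ (j, r)"
      by (simp add: window_def)
  qed (simp_all add: window_def)
  then have "det (window D (a \<circ> \<pi>) q) = of_int (sign c) * det (window D a (\<pi> q))"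
    by (simp add: det_permute_rows[OF window_carrier cD])
  moreover have "sign c = sign (reflect D (\<pi> q)) * sign \<pi> * sign (reflect D q)"
  proof -
    have "permutation p" if "p permutes {0..<D+1}" for p
      using that by (rule permutation_permutes[THEN iffD2, OF exI, OF conjI, rotated]) simp
    then show ?thesis using perms unfolding c_def
      by (simp add: sign_compose permutation_compose)
  qed
  ultimately show ?thesis by simp
qed

text \<open>
  As \<open>q\<close> runs over all windows, so does \<open>\<pi> q\<close>. Hence the sign of each row numbering occurs twice and
  cancels, which leaves one factor \<open>sgn(\<pi>)\<close> per window.
\<close>
lemma window_product_permute:
  assumes \<pi>: "\<pi> permutes {0..<D+1}"
  shows "window_product D (a \<circ> \<pi>) = of_int (sign \<pi>) ^ (D + 1) * window_product D a"
proof -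
  have reindex: "(\<Prod>q\<in>{0..<D+1}. F (\<pi> q)) = (\<Prod>q\<in>{0..<D+1}. F q)" for F :: "nat \<Rightarrow> complex"
    by (rule prod.permute[OF \<pi>, symmetric, unfolded comp_def])
  define s where "s = (\<lambda>q. of_int (sign (reflect D q)) :: complex)"
  have "window_product D (a \<circ> \<pi>)
      = (\<Prod>q\<in>{0..<D+1}. s (\<pi> q) * of_int (sign \<pi>) * s q * det (window D a (\<pi> q)))"
    unfolding window_product_def s_def by (intro prod.cong refl) (simp add: det_window_permute[OF \<pi>])
  also have "\<dots> = (\<Prod>q\<in>{0..<D+1}. s (\<pi> q)) * of_int (sign \<pi>) ^ (D + 1) * (\<Prod>q\<in>{0..<D+1}. s q) *
      (\<Prod>q\<in>{0..<D+1}. det (window D a (\<pi> q)))"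
    by (simp only: prod.distrib) simp
  also have "\<dots> = of_int (sign \<pi>) ^ (D + 1) * (\<Prod>q\<in>{0..<D+1}. s q * s q) * window_product D a"
    unfolding reindex[of s] reindex[of "\<lambda>q. det (window D a q)"] window_product_def
    by (simp only: prod.distrib mult_ac)
  also have "(\<Prod>q\<in>{0..<D+1}. s q * s q) = 1"
    unfolding s_def by (intro prod.neutral) (simp flip: of_int_mult)
  finally show ?thesis by (simp only: mult_1_right)
qed

lemma P_poly_sum_of_powers:
  fixes c :: "'s \<Rightarrow> complex" and a :: "'s \<Rightarrow> nat \<Rightarrow> complex"
  assumes S: "finite S"
    and v: "\<And>\<mu>. \<mu> \<in> multi_idx D \<Longrightarrow> v \<mu> = (\<Sum>s\<in>S. c s * (\<Prod>j\<in>{0..<D}. a s (\<mu> j)))"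
  shows "P_poly D v = (\<Sum>f\<in>{0..<D+1} \<rightarrow>\<^sub>E S.
           (\<Prod>i\<in>{0..<D+1}. c (f i)) * window_product D (a \<circ> f))"
proof -
  have "(\<Prod>m\<in>{0..<D+1}. det (mat D D (\<lambda>(j, r). a (f ((m + (D + 1) - j) mod (D + 1))) r)))
      = window_product D (a \<circ> f)" for f
  proof -
    (* The rows m, m - 1, ..., m - D + 1 omit m - D, which is m + 1 modulo D + 1. *)
    have rows: "mat D D (\<lambda>(j, r). a (f ((m + (D + 1) - j) mod (D + 1))) r)
        = window D (a \<circ> f) ((m + 1) mod (D + 1))" for m
    proof -
      have "(m + (D + 1) - j) mod (D + 1) = ((m + 1) mod (D + 1) + D - j) mod (D + 1)"
        if "j < D" for j
      proof -
        have "((m + 1) mod (D + 1) + D - j) mod (D + 1) = ((m + 1) mod (D + 1) + (D - j)) mod (D + 1)"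
          using that by simp
        also have "\<dots> = (m + 1 + (D - j)) mod (D + 1)" by (rule mod_add_left_eq)
        also have "m + 1 + (D - j) = m + (D + 1) - j" using that by simp
        finally show ?thesis by (rule sym)
      qed
      then show ?thesis by (intro eq_matI) (simp_all add: window_def)
    qed
    show ?thesis
    proof (cases "D = 0")
      case True
      then show ?thesis by (simp add: window_product_def window_def det_def)
    next
      case False
      then have "1 < D + 1" by simp
      then show ?thesis
        unfolding window_product_def rows by (intro prod.reindex_bij_betw bij_betw_add_mod)
    qed
  qed
  then show ?thesis
    using P_poly_sum_of_products[OF S, of D v c "\<lambda>s j. a s"] v by simp
qed

section \<open>Polarization and the even case\<close>

text \<open>
  Ryser's formula. Multiplying out, a function \<open>h\<close> contributes for each \<open>X\<close> containing its image,
  and the alternating sum over these \<open>X\<close> vanishes unless \<open>h\<close> is onto, that is, a permutation.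
\<close>
lemma permanent_inclusion_exclusion:
  fixes x :: "nat \<Rightarrow> nat \<Rightarrow> complex"
  shows "(\<Sum>X\<in>Pow {0..<D}. (-1) ^ card ({0..<D} - X) * (\<Prod>j\<in>{0..<D}. \<Sum>s\<in>X. x s j))
       = (\<Sum>\<pi> | \<pi> permutes {0..<D}. \<Prod>j\<in>{0..<D}. x (\<pi> j) j)"
proof -
  let ?A = "{0..<D}"
  have expand: "(\<Prod>j\<in>?A. \<Sum>s\<in>X. x s j)
      = (\<Sum>h\<in>?A \<rightarrow>\<^sub>E ?A. of_bool (h ` ?A \<subseteq> X) * (\<Prod>j\<in>?A. x (h j) j))" if "X \<subseteq> ?A" for X
  proof -
    have "(\<Prod>j\<in>?A. \<Sum>s\<in>X. x s j) = (\<Sum>h\<in>?A \<rightarrow>\<^sub>E X. \<Prod>j\<in>?A. x (h j) j)"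
      using that by (intro prod_sum_PiE) (auto intro: finite_subset)
    also have "\<dots> = (\<Sum>h\<in>?A \<rightarrow>\<^sub>E ?A. of_bool (h ` ?A \<subseteq> X) * (\<Prod>j\<in>?A. x (h j) j))"
      using that by (intro sum.mono_neutral_cong_left finite_PiE) (auto simp: PiE_iff)
    finally show ?thesis .
  qed
  have alternating: "(\<Sum>X\<in>Pow ?A. (-1) ^ card (?A - X) * of_bool (h ` ?A \<subseteq> X))
      = (of_bool (h ` ?A = ?A) :: complex)" if "h \<in> ?A \<rightarrow>\<^sub>E ?A" for h
  proof -
    have sub: "h ` ?A \<subseteq> ?A" using that by auto
    have "(\<Prod>s\<in>?A. 1 - of_bool (s \<notin> h ` ?A) :: complex)
        = (\<Sum>X\<in>Pow ?A. (-1) ^ card (?A - X) * (\<Prod>s\<in>X. 1) * (\<Prod>s\<in>?A - X. of_bool (s \<notin> h ` ?A)))"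
      by (subst prod_diff_conv_sum')
        (auto intro!: sum.cong simp: card_Diff_subset finite_subset[of _ ?A])
    also have "\<dots> = (\<Sum>X\<in>Pow ?A. (-1) ^ card (?A - X) * of_bool (h ` ?A \<subseteq> X))"
    proof (intro sum.cong refl)
      fix X assume "X \<in> Pow ?A"
      have "(\<Prod>s\<in>?A - X. of_bool (s \<notin> h ` ?A)) = (of_bool (h ` ?A \<subseteq> X) :: complex)"
        using sub by (auto simp: of_bool_def prod_zero_iff intro!: prod.neutral)
      then show "(-1) ^ card (?A - X) * (\<Prod>s\<in>X. 1) * (\<Prod>s\<in>?A - X. of_bool (s \<notin> h ` ?A))
          = (-1) ^ card (?A - X) * (of_bool (h ` ?A \<subseteq> X) :: complex)" by simp
    qed
    finally have "(\<Sum>X\<in>Pow ?A. (-1) ^ card (?A - X) * of_bool (h ` ?A \<subseteq> X))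
        = (\<Prod>s\<in>?A. of_bool (s \<in> h ` ?A) :: complex)"
      by (simp flip: of_bool_not_iff)
    also have "\<dots> = of_bool (?A \<subseteq> h ` ?A)"
      by (cases "?A \<subseteq> h ` ?A") (auto simp: prod_zero_iff intro!: prod.neutral)
    also have "?A \<subseteq> h ` ?A \<longleftrightarrow> h ` ?A = ?A" using sub by blast
    finally show ?thesis .
  qed
  have "(\<Sum>X\<in>Pow ?A. (-1) ^ card (?A - X) * (\<Prod>j\<in>?A. \<Sum>s\<in>X. x s j))
      = (\<Sum>X\<in>Pow ?A. \<Sum>h\<in>?A \<rightarrow>\<^sub>E ?A.
           ((-1) ^ card (?A - X) * of_bool (h ` ?A \<subseteq> X)) * (\<Prod>j\<in>?A. x (h j) j))"
    by (intro sum.cong refl) (simp only: Pow_iff expand sum_distrib_left mult.assoc)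
  also have "\<dots> = (\<Sum>h\<in>?A \<rightarrow>\<^sub>E ?A. of_bool (h ` ?A = ?A) * (\<Prod>j\<in>?A. x (h j) j))"
    by (subst sum.swap) (intro sum.cong refl, simp only: sum_distrib_right[symmetric] alternating)
  also have "\<dots> = (\<Sum>h | h \<in> ?A \<rightarrow>\<^sub>E ?A \<and> h ` ?A = ?A. \<Prod>j\<in>?A. x (h j) j)"
    by (intro sum.mono_neutral_cong_right finite_PiE) auto
  also have "\<dots> = (\<Sum>\<pi> | \<pi> permutes ?A. \<Prod>j\<in>?A. x (\<pi> j) j)"
  proof (rule sum.reindex_bij_witness[where j = "\<lambda>h k. if k \<in> ?A then h k else k"
        and i = "\<lambda>\<pi>. restrict \<pi> ?A"])
    fix h assume h: "h \<in> {h. h \<in> ?A \<rightarrow>\<^sub>E ?A \<and> h ` ?A = ?A}"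
    then have "inj_on h ?A" by (intro eq_card_imp_inj_on) auto
    with h have "bij_betw h ?A ?A" by (auto simp: bij_betw_def)
    then have "bij_betw (\<lambda>k. if k \<in> ?A then h k else k) ?A ?A"
      by (rule bij_betw_cong[THEN iffD1, rotated]) simp
    then show "(\<lambda>k. if k \<in> ?A then h k else k) \<in> {\<pi>. \<pi> permutes ?A}"
      by (auto intro: bij_imp_permutes)
    show "restrict (\<lambda>k. if k \<in> ?A then h k else k) ?A = h"
      using h by (auto simp: fun_eq_iff PiE_iff extensional_def restrict_def)
  next
    fix \<pi> assume "\<pi> \<in> {\<pi>. \<pi> permutes ?A}"
    then have \<pi>: "\<pi> permutes ?A" by simp
    show "(\<lambda>k. if k \<in> ?A then restrict \<pi> ?A k else k) = \<pi>"
      using permutes_not_in[OF \<pi>] by (auto simp: fun_eq_iff)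
    show "restrict \<pi> ?A \<in> {h. h \<in> ?A \<rightarrow>\<^sub>E ?A \<and> h ` ?A = ?A}"
      using permutes_image[OF \<pi>] by auto
  qed (auto intro!: prod.cong)
  finally show ?thesis .
qed

text \<open>
  By symmetry each basis tensor \<open>e\<^sub>\<nu>\<close> may be replaced by its average over the \<open>D!\<close> permutations of
  the slots. The coordinates of that average are permanents, and Ryser's formula writes them through
  the powers of the vectors \<open>\<Sum>\<^bsub>s\<in>X\<^esub> e\<^bsub>\<nu> s\<^esub>\<close>.
\<close>
lemma symmetric_tensor_sum_of_powers:
  assumes v: "v \<in> sym_tensors D" and \<mu>: "\<mu> \<in> multi_idx D"
  shows "v \<mu> = (\<Sum>(\<nu>, X)\<in>multi_idx D \<times> Pow {0..<D}.
    (v \<nu> * (-1) ^ card ({0..<D} - X) / fact D) * (\<Prod>j\<in>{0..<D}. \<Sum>s\<in>X. of_bool (\<nu> s = \<mu> j)))"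
proof -
  let ?A = "{0..<D}"
  have unique: "(\<Sum>\<nu>\<in>multi_idx D. v \<nu> * (\<Prod>j\<in>?A. of_bool (\<nu> (\<pi> j) = \<mu> j))) = v \<mu>"
    if \<pi>: "\<pi> permutes ?A" for \<pi>
  proof -
    define \<pi>' where "\<pi>' = Hilbert_Choice.inv \<pi>"
    let ?\<nu> = "\<mu> \<circ> \<pi>'"
    have inv: "\<pi>' permutes ?A" unfolding \<pi>'_def by (rule permutes_inv[OF \<pi>])
    have mem: "?\<nu> \<in> multi_idx D"
      using \<mu> permutes_in_image[OF inv] permutes_not_in[OF inv]
      by (auto simp: multi_idx_def PiE_iff extensional_def simp del: atLeastLessThan_iff)
    have "(\<Prod>j\<in>?A. of_bool (\<nu> (\<pi> j) = \<mu> j)) = (of_bool (\<nu> = ?\<nu>) :: complex)"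
      if \<nu>: "\<nu> \<in> multi_idx D" for \<nu>
    proof -
      have "(\<forall>j\<in>?A. \<nu> (\<pi> j) = \<mu> j) \<longleftrightarrow> \<nu> = ?\<nu>"
      proof
        assume eq: "\<forall>j\<in>?A. \<nu> (\<pi> j) = \<mu> j"
        show "\<nu> = ?\<nu>"
        proof (rule PiE_ext[of _ ?A "\<lambda>_. ?A"])
          fix k assume "k \<in> ?A"
          then have "\<pi>' k \<in> ?A" using permutes_in_image[OF inv] by blast
          then show "\<nu> k = ?\<nu> k" using eq permutes_inverses(1)[OF \<pi>, folded \<pi>'_def] by (metis comp_apply)
        qed (use \<nu> mem in \<open>simp_all add: multi_idx_def\<close>)
      next
        assume "\<nu> = ?\<nu>"
        then show "\<forall>j\<in>?A. \<nu> (\<pi> j) = \<mu> j" using permutes_inverses(2)[OF \<pi>, folded \<pi>'_def] by simp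
      qed
      moreover have "(\<Prod>j\<in>?A. of_bool (\<nu> (\<pi> j) = \<mu> j)) = (of_bool (\<forall>j\<in>?A. \<nu> (\<pi> j) = \<mu> j) :: complex)"
        by (auto simp: of_bool_def prod_zero_iff intro!: prod.neutral)
      ultimately show ?thesis by simp
    qed
    then have "(\<Sum>\<nu>\<in>multi_idx D. v \<nu> * (\<Prod>j\<in>?A. of_bool (\<nu> (\<pi> j) = \<mu> j)))
        = (\<Sum>\<nu>\<in>multi_idx D. if \<nu> = ?\<nu> then v \<nu> else 0)"
      by (intro sum.cong refl) simp
    also have "\<dots> = v ?\<nu>" using mem by simp
    also have "\<dots> = v \<mu>" using v inv \<mu> by (simp add: sym_tensors_def)
    finally show ?thesis .
  qed
  have "(\<Sum>(\<nu>, X)\<in>multi_idx D \<times> Pow ?A.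
      (v \<nu> * (-1) ^ card (?A - X) / fact D) * (\<Prod>j\<in>?A. \<Sum>s\<in>X. of_bool (\<nu> s = \<mu> j)))
      = (\<Sum>\<nu>\<in>multi_idx D. v \<nu> / fact D *
          (\<Sum>X\<in>Pow ?A. (-1) ^ card (?A - X) * (\<Prod>j\<in>?A. \<Sum>s\<in>X. of_bool (\<nu> s = \<mu> j))))"
    by (simp add: sum.cartesian_product[symmetric] sum_distrib_left mult_ac)
  also have "\<dots> = (\<Sum>\<pi> | \<pi> permutes ?A.
      (\<Sum>\<nu>\<in>multi_idx D. v \<nu> * (\<Prod>j\<in>?A. of_bool (\<nu> (\<pi> j) = \<mu> j))) / fact D)"
    unfolding permanent_inclusion_exclusion
    by (simp only: sum_distrib_left sum_divide_distrib, subst sum.swap) (simp add: mult_ac)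
  also have "\<dots> = (\<Sum>\<pi> | \<pi> permutes ?A. v \<mu> / fact D)"
    by (intro sum.cong refl) (simp add: unique)
  also have "\<dots> = v \<mu>"
    by (simp add: card_permutations[of ?A D])
  finally show ?thesis by simp
qed

text \<open>
  Exchanging the choices made in factors 0 and 1 is an involution on the terms of the expansion. It
  keeps the coefficient and negates the window product, since \<open>D + 1\<close> is odd.
\<close>
lemma P_poly_symmetric_even:
  assumes v: "v \<in> sym_tensors D" and D: "even D" "D \<ge> 1"
  shows "P_poly D v = 0"
proof -
  define S where "S = multi_idx D \<times> Pow {0..<D}"
  define c where "c = (\<lambda>(\<nu>, X). v \<nu> * (-1) ^ card ({0..<D} - X) / fact D)"
  define a :: "(nat \<Rightarrow> nat) \<times> nat set \<Rightarrow> nat \<Rightarrow> complex"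
    where "a = (\<lambda>(\<nu>, X) r. \<Sum>s\<in>X. of_bool (\<nu> s = r))"
  define T where "T f = (\<Prod>i\<in>{0..<D+1}. c (f i)) * window_product D (a \<circ> f)" for f
  define \<tau> where "\<tau> = transpose 0 (1 :: nat)"
  have P: "P_poly D v = sum T ({0..<D+1} \<rightarrow>\<^sub>E S)"
    unfolding T_def
    by (rule P_poly_sum_of_powers)
      (simp_all add: S_def c_def a_def symmetric_tensor_sum_of_powers[OF v] split_beta)
  have \<tau>: "\<tau> permutes {0..<D+1}" unfolding \<tau>_def using D by (intro permutes_swap_id) auto
  have \<tau>\<tau>: "\<tau> \<circ> \<tau> = id" by (simp add: \<tau>_def)
  have T\<tau>: "T (f \<circ> \<tau>) = - T f" for f
  proof -
    have "window_product D ((a \<circ> f) \<circ> \<tau>) = - window_product D (a \<circ> f)"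
      using D by (subst window_product_permute[OF \<tau>]) (simp add: \<tau>_def sign_swap_id)
    moreover have "(\<Prod>i\<in>{0..<D+1}. c ((f \<circ> \<tau>) i)) = (\<Prod>i\<in>{0..<D+1}. c (f i))"
      using prod.permute[OF \<tau>, of "c \<circ> f"] by (simp add: comp_def)
    ultimately show ?thesis by (simp add: T_def comp_assoc)
  qed
  have mem: "f \<circ> \<tau> \<in> {0..<D+1} \<rightarrow>\<^sub>E S" if "f \<in> {0..<D+1} \<rightarrow>\<^sub>E S" for f
    using that permutes_in_image[OF \<tau>] permutes_not_in[OF \<tau>]
    by (auto simp: PiE_iff extensional_def simp del: atLeastLessThan_iff)
  have "sum T ({0..<D+1} \<rightarrow>\<^sub>E S) = sum (\<lambda>f. T (f \<circ> \<tau>)) ({0..<D+1} \<rightarrow>\<^sub>E S)"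
    by (rule sum.reindex_bij_witness[where i = "\<lambda>f. f \<circ> \<tau>" and j = "\<lambda>f. f \<circ> \<tau>"])
      (simp_all only: comp_assoc \<tau>\<tau> comp_id mem)
  also have "\<dots> = - sum T ({0..<D+1} \<rightarrow>\<^sub>E S)" by (simp add: T\<tau> sum_negf)
  finally show ?thesis using P by simp
qed

section \<open>The odd case\<close>

text \<open>
  The vectors \<open>e\<^sub>0, \<dots>, e\<^bsub>D-1\<^esub>\<close>, followed by their sum at \<open>s = D\<close>: up to scaling, \<open>D + 1\<close>
  vectors in general position.
\<close>
definition simplex_form :: "nat \<Rightarrow> nat \<Rightarrow> nat \<Rightarrow> complex" where
  "simplex_form D s r = of_bool (s = D \<or> s = r)"

text \<open>
  A vector \<open>x\<close> in the kernel is orthogonal to all vectors but number \<open>q\<close>. The unit vectors kill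
  its coordinates outside \<open>q\<close>. If \<open>q < D\<close>, the all-ones vector is present and kills the last one.
\<close>
lemma det_window_simplex_form_nonzero:
  assumes q: "q < D + 1"
  shows "det (window D (simplex_form D) q) \<noteq> 0"
proof
  assume "det (window D (simplex_form D) q) = 0"
  then obtain x where x: "x \<in> carrier_vec D" "x \<noteq> 0\<^sub>v D"
    and Ax: "window D (simplex_form D) q *\<^sub>v x = 0\<^sub>v D"
    using det_0_iff_vec_prod_zero[OF window_carrier] by blast
  have pairing: "(\<Sum>r\<in>{0..<D}. simplex_form D s r * x $ r) = 0" if s: "s < D + 1" "s \<noteq> q" for s
  proof -
    define j where "j = reflect D q s"
    have sj: "reflect D q j = s" unfolding j_def by (rule reflect_reflect[OF q])
    have "j < D + 1" using s by (simp add: j_def reflect_def)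
    moreover have "j \<noteq> D" using sj s q by (auto simp: reflect_def)
    ultimately have j: "j < D" by simp
    then have "(q + D - j) mod (D + 1) = s" using sj by (simp add: reflect_def)
    moreover have "(window D (simplex_form D) q *\<^sub>v x) $ j = 0" using Ax j by simp
    ultimately show ?thesis using j x by (simp add: window_def scalar_prod_def)
  qed
  have coord: "x $ s = 0" if "s < D" "s \<noteq> q" for s
  proof -
    have "(\<Sum>r\<in>{0..<D}. simplex_form D s r * x $ r) = (\<Sum>r\<in>{0..<D}. if r = s then x $ s else 0)"
      using that by (intro sum.cong) (auto simp: simplex_form_def)
    then show ?thesis using pairing[of s] that by simp
  qed
  have "x $ q = 0" if "q < D"
  proof -
    have "(\<Sum>r\<in>{0..<D}. x $ r) = 0" using pairing[of D] that by (simp add: simplex_form_def)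
    moreover have "(\<Sum>r\<in>{0..<D}. x $ r) = (\<Sum>r\<in>{0..<D}. if r = q then x $ q else 0)"
      using coord by (intro sum.cong) auto
    ultimately show ?thesis using that by simp
  qed
  with coord have "x $ s = 0" if "s < D" for s using that by metis
  then have "x = 0\<^sub>v D" using x(1) by (intro eq_vecI) auto
  with x show False by simp
qed

text \<open>
  There are at least three indices, so some window omits neither of two equal vectors and has a
  repeated row. For \<open>D = 1\<close> a window has only one row, and the conclusion fails.
\<close>
lemma window_product_not_inj:
  assumes D: "D \<ge> 2" and f: "\<not> inj_on f {0..<D+1}"
  shows "window_product D (a \<circ> f) = 0"
proof -
  obtain i k where ik: "i < D + 1" "k < D + 1" "i \<noteq> k" "f i = f k"
    using f by (auto simp: inj_on_def)
  have "\<not> {0..<D+1} \<subseteq> {i, k}"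
  proof
    assume "{0..<D+1} \<subseteq> {i, k}"
    then have "card {0..<D+1} \<le> card {i, k}" by (intro card_mono) auto
    with ik D show False by simp
  qed
  then have "\<exists>q\<in>{0..<D+1}. q \<notin> {i, k}" by blast
  then obtain q where q: "q < D + 1" "q \<noteq> i" "q \<noteq> k" by auto
  define j where "j = reflect D q"
  have jD: "j s < D \<and> (q + D - j s) mod (D + 1) = s" if s: "s < D + 1" "s \<noteq> q" for s
  proof -
    have sj: "reflect D q (j s) = s" unfolding j_def by (rule reflect_reflect[OF q(1)])
    have le: "j s < D + 1" using s by (simp add: j_def reflect_def)
    moreover have "j s \<noteq> D" using sj s q by (auto simp: reflect_def)
    ultimately show ?thesis using sj by (simp add: reflect_def)
  qed
  have i: "j i < D \<and> (q + D - j i) mod (D + 1) = i" and k: "j k < D \<and> (q + D - j k) mod (D + 1) = k"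
    using jD ik q by auto
  have "det (window D (a \<circ> f) q) = 0"
  proof (rule det_identical_rows[OF window_carrier])
    show "j i \<noteq> j k" using i k ik by metis
    show "row (window D (a \<circ> f) q) (j i) = row (window D (a \<circ> f) q) (j k)"
      using i k ik by (intro eq_vecI) (simp_all add: window_def)
  qed (use i k in auto)
  then show ?thesis unfolding window_product_def using q by (intro prod_zero) auto
qed

text \<open>Such an \<open>f\<close> is a permutation, and \<open>D + 1\<close> is even.\<close>
lemma window_product_simplex_form_inj:
  assumes D: "odd D" and f: "f \<in> {0..<D+1} \<rightarrow>\<^sub>E {0..<D+1}" "inj_on f {0..<D+1}"
  shows "window_product D (simplex_form D \<circ> f) = window_product D (simplex_form D)"
proof -
  define \<pi> where "\<pi> k = (if k \<in> {0..<D+1} then f k else k)" for k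
  have "f ` {0..<D+1} = {0..<D+1}" using f by (intro endo_inj_surj) auto
  with f have "bij_betw f {0..<D+1} {0..<D+1}" by (simp add: bij_betw_def)
  then have "bij_betw \<pi> {0..<D+1} {0..<D+1}"
    by (rule bij_betw_cong[THEN iffD1, rotated]) (simp add: \<pi>_def)
  then have \<pi>: "\<pi> permutes {0..<D+1}" by (rule bij_imp_permutes) (simp add: \<pi>_def)
  have "window D (simplex_form D \<circ> f) q = window D (simplex_form D \<circ> \<pi>) q" for q
    by (intro eq_matI) (simp_all add: window_def \<pi>_def)
  then have "window_product D (simplex_form D \<circ> f) = window_product D (simplex_form D \<circ> \<pi>)"
    by (simp add: window_product_def)
  also have "\<dots> = window_product D (simplex_form D)"
    using D by (simp add: window_product_permute[OF \<pi>] sign_def)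
  finally show ?thesis .
qed

lemma P_poly_symmetric_odd:
  assumes D: "odd D"
  shows "\<exists>v\<in>sym_tensors D. P_poly D v \<noteq> 0"
proof
  define v where "v \<mu> = (if \<mu> \<in> multi_idx D then
    (\<Sum>s\<in>{0..<D+1}. \<Prod>j\<in>{0..<D}. simplex_form D s (\<mu> j)) else 0)" for \<mu>
  show "v \<in> sym_tensors D"
  proof -
    have "v (\<nu> \<circ> \<pi>) = v \<nu>" if \<pi>: "\<pi> permutes {0..<D}" and \<nu>: "\<nu> \<in> multi_idx D" for \<pi> \<nu>
    proof -
      have "\<nu> \<circ> \<pi> \<in> multi_idx D"
        using \<nu> permutes_in_image[OF \<pi>] permutes_not_in[OF \<pi>]
        by (auto simp: multi_idx_def PiE_iff extensional_def simp del: atLeastLessThan_iff)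
      moreover have "(\<Prod>j\<in>{0..<D}. simplex_form D s ((\<nu> \<circ> \<pi>) j)) = (\<Prod>j\<in>{0..<D}. simplex_form D s (\<nu> j))"
        for s using prod.permute[OF \<pi>, of "\<lambda>j. simplex_form D s (\<nu> j)"] by (simp add: comp_def)
      ultimately show ?thesis using \<nu> by (simp add: v_def)
    qed
    then show ?thesis by (simp add: sym_tensors_def tensors_def v_def)
  qed
  let ?F = "{0..<D+1} \<rightarrow>\<^sub>E {0..<D+1}"
  have P: "P_poly D v = (\<Sum>f\<in>?F. window_product D (simplex_form D \<circ> f))"
    by (subst P_poly_sum_of_powers[where S = "{0..<D+1}" and c = "\<lambda>_. 1" and a = "simplex_form D"])
      (simp_all add: v_def)
  have finF: "finite ?F" by (intro finite_PiE) auto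
  have nonzero: "window_product D (simplex_form D) \<noteq> 0"
    by (simp add: window_product_def det_window_simplex_form_nonzero)
  (* All terms over B are equal and those outside B vanish. For D = 1 the two vectors coincide, so
     constant choices contribute as much as the others. *)
  define B where "B = (if D = 1 then ?F else {f \<in> ?F. inj_on f {0..<D+1}})"
  have B: "finite B" "restrict id {0..<D+1} \<in> B"
    using finF by (auto simp: B_def inj_on_def)
  have "P_poly D v = (\<Sum>f\<in>B. window_product D (simplex_form D \<circ> f))"
    unfolding P
  proof (rule sum.mono_neutral_right[OF finF])
    have "D \<ge> 2" if "D \<noteq> 1" using D that by (cases D) auto
    then show "\<forall>f\<in>?F - B. window_product D (simplex_form D \<circ> f) = 0"
      by (auto simp: B_def window_product_not_inj)
  qed (auto simp: B_def)
  also have "\<dots> = (\<Sum>f\<in>B. window_product D (simplex_form D))"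
  proof (intro sum.cong refl)
    fix f assume f: "f \<in> B"
    show "window_product D (simplex_form D \<circ> f) = window_product D (simplex_form D)"
    proof (cases "D = 1")
      case True
      have one: "simplex_form 1 s 0 = 1" if "s < 2" for s
        using that by (auto simp: simplex_form_def)
      have "f \<in> {0..<2} \<rightarrow>\<^sub>E {0..<2}" using f True by (simp add: B_def numeral_2_eq_2)
      then have "f s < 2" if "s < 2" for s using that by (auto simp: PiE_iff)
      then have eq: "simplex_form 1 (f (t mod 2)) 0 = simplex_form 1 (t mod 2) 0" for t
        by (simp only: one mod_less_divisor zero_less_numeral)
      have "window 1 (simplex_form 1 \<circ> f) q = window 1 (simplex_form 1) q" for q
        by (intro eq_matI) (simp_all add: window_def eq[unfolded numeral_2_eq_2 One_nat_def])
      with True show ?thesis by (simp add: window_product_def)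
    next
      case False
      with f show ?thesis by (intro window_product_simplex_form_inj[OF D]) (auto simp: B_def)
    qed
  qed
  also have "\<dots> = of_nat (card B) * window_product D (simplex_form D)" by simp
  finally show "P_poly D v \<noteq> 0" using B nonzero by (auto simp: card_eq_0_iff)
qed

theorem theorem3p22:
  fixes D :: nat
  assumes "D \<ge> 1"
  shows "(\<forall>g\<in>GL D. \<forall>v\<in>tensors D. P_poly D (tensor_act D g v) = det g ^ (D + 1) * P_poly D v) \<and>
         ((\<exists>v\<in>sym_tensors D. P_poly D v \<noteq> 0) \<longleftrightarrow> odd D)"
  using P_poly_tensor_act P_poly_symmetric_even P_poly_symmetric_odd assms
  by (auto simp: GL_def)

end
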